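(* Let $p:\widetilde{\mathcal W}\to\mathcal W$ be a covering of Weyl data of type $M$. Then $\widetilde{\mathcal W}$ is a Weyl graph if and only if $\mathcal W$ is a Weyl graph.
   Context: Setting. $M=(m_{st})_{s,t\in S}$ is a Coxeter matrix on a finite set $S$, and $W=\langle S\mid (st)^{m_{st}}=1,\ m_{st}<\infty\rangle$ is its Coxeter group. A word over $S$ is reduced if no shorter word represents the same element of $W$. For $s\ne t$ let $p_m(s,t)=stst\cdots$ ($m$ letters), and if $m_{st}<\infty$ let $p(s,t)=p_{m_{st}}(s,t)$. Groupoids are small and non-empty, with composition $g;h$ (or $gh$) written left to right, defined when $\tau(g)=\iota(h)$, where $\iota,\tau$ denote initial and terminal vertices. Weyl data. A generalized chamber system $\mathcal W$ of type $M$ is a set $\mathcal W_0$ of chambers with a family of groupoids $(\mathcal W_s)_{s\in S}$ (panel groupoids), each with vertex set $\mathcal W_0$. An edge of $\mathcal W$ of type $s$ is a non-identity edge of $\mathcal W_s$ (edges of different types are distinct). An $s$-panel is a connected component of $\mathcal W_s$. A gallery $\beta$ is a finite sequence of consecutive edges (a trivial gallery is a single chamber with no edges), with initial chamber $\iota(\beta)$, terminal chamber $\tau(\beta)$, type $\beta_S$ (the word of types of its edges), and $W$-length $\beta_W\in W$ (the element represented by $\beta_S$). It is a cycle if $\iota(\beta)=\tau(\beta)$, and a geodesic if $\beta_S$ is reduced. For $s\neq t$ with $m_{st}<\infty$: a maximal $(s,t)$-geodesic is a gallery of type $p(s,t)$; an $(s,t)$-cycle is a cycle of type $p_{2m_{st}}(s,t)$.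 Weyl data of type $M$ is a generalized chamber system of type $M$ together with, for each ordered pair $(s,t)$ with $s\neq t$, $m_{st}<\infty$, a set of $(s,t)$-cycles called defining suites. Homotopy. Elementary homotopies of galleries are the following moves on subgalleries and their inverses: delete $i\,i^{-1}$; replace $i\,i'$ ($i,i'$ of the same type, $i'\ne i^{-1}$) by the single edge $i;i'$; delete a defining suite. Galleries are homotopic ($\sim$) if related by finitely many such moves. A suite is an $(s,t)$-cycle homotopic to a trivial gallery. Morphisms and coverings. A morphism of generalized chamber systems of type $M$ is a map on chambers and edges preserving extremities, types and inverses, with $\omega(i;i')=\omega(i);\omega(i')$ whenever $i,i'$ are composable of the same type and $i'\neq i^{-1}$. A morphism of Weyl data is such a morphism sending defining suites to suites. A morphism is surjective-étale if it is surjective on chambers and, for every chamber $C$, restricts to a bijection from the edges issuing from $C$ to the edges issuing from the image of $C$. A covering $p:\widetilde{\mathcal W}\to\mathcal W$ of Weyl data is a surjective-étale morphism of Weyl data such that every gallery $\beta$ of $\widetilde{\mathcal W}$ with $p\circ\beta$ a defining suite of $\mathcal W$ is a suite of $\widetilde{\mathcal W}$. A pre-Weyl graph is Weyl data satisfying (PW0) no panel is a trivial groupoid (one vertex, one edge), and (PW1) each maximal $(s,t)$-geodesic is homotopic to a maximal $(t,s)$-geodesic. A Weyl graph is a pre-Weyl graph satisfying (W) homotopic geodesics have the same $W$-length. *)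

theory Defs
  imports "HOL-Algebra.Group" "HOL-Library.Extended_Nat"
begin

section \<open>Coxeter groups\<close>

locale coxeter_matrix =
  fixes S :: "'s set" and M :: "'s \<Rightarrow> 's \<Rightarrow> enat"
  assumes finite_S: "finite S"
    and diag: "s \<in> S \<Longrightarrow> M s s = 1"
    and sym: "s \<in> S \<Longrightarrow> t \<in> S \<Longrightarrow> M s t = M t s"
    and off_diag: "s \<in> S \<Longrightarrow> t \<in> S \<Longrightarrow> s \<noteq> t \<Longrightarrow> M s t \<ge> 2"

text \<open>The group presentation is spelled out on signed words, where \<open>(s, True)\<close> stands for the
  generator \<open>s\<close> and \<open>(s, False)\<close> for its formal inverse.\<close>

inductive cox_eq :: "'s set \<Rightarrow> ('s \<Rightarrow> 's \<Rightarrow> enat) \<Rightarrow> ('s \<times> bool) list \<Rightarrow> ('s \<times> bool) list \<Rightarrow> bool"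
  for S M where
  refl: "w \<in> lists (S \<times> UNIV) \<Longrightarrow> cox_eq S M w w"
| sym: "cox_eq S M v w \<Longrightarrow> cox_eq S M w v"
| trans: "cox_eq S M u v \<Longrightarrow> cox_eq S M v w \<Longrightarrow> cox_eq S M u w"
| cancel: "u \<in> lists (S \<times> UNIV) \<Longrightarrow> v \<in> lists (S \<times> UNIV) \<Longrightarrow> s \<in> S \<Longrightarrow>
    cox_eq S M (u @ [(s, b), (s, \<not> b)] @ v) (u @ v)"
| relator: "u \<in> lists (S \<times> UNIV) \<Longrightarrow> v \<in> lists (S \<times> UNIV) \<Longrightarrow> s \<in> S \<Longrightarrow> t \<in> S \<Longrightarrow> M s t \<noteq> \<infinity> \<Longrightarrow>
    cox_eq S M (u @ concat (replicate (the_enat (M s t)) [(s, True), (t, True)]) @ v) (u @ v)"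

definition cox_rel :: "'s set \<Rightarrow> ('s \<Rightarrow> 's \<Rightarrow> enat) \<Rightarrow> (('s \<times> bool) list \<times> ('s \<times> bool) list) set" where
  "cox_rel S M = {(v, w). cox_eq S M v w}"

definition coxeter_group :: "'s set \<Rightarrow> ('s \<Rightarrow> 's \<Rightarrow> enat) \<Rightarrow> ('s \<times> bool) list set monoid" where
  "coxeter_group S M =
    \<lparr> carrier = lists (S \<times> UNIV) // cox_rel S M,
      mult = (\<lambda>A B. \<Union>a\<in>A. \<Union>b\<in>B. cox_rel S M `` {a @ b}),
      one = cox_rel S M `` {[]} \<rparr>"

definition cox_gen :: "'s set \<Rightarrow> ('s \<Rightarrow> 's \<Rightarrow> enat) \<Rightarrow> 's \<Rightarrow> ('s \<times> bool) list set" where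
  "cox_gen S M s = cox_rel S M `` {[(s, True)]}"

definition word_elt :: "'s set \<Rightarrow> ('s \<Rightarrow> 's \<Rightarrow> enat) \<Rightarrow> 's list \<Rightarrow> ('s \<times> bool) list set" where
  "word_elt S M w =
    foldr (\<lambda>s x. cox_gen S M s \<otimes>\<^bsub>coxeter_group S M\<^esub> x) w \<one>\<^bsub>coxeter_group S M\<^esub>"

definition reduced :: "'s set \<Rightarrow> ('s \<Rightarrow> 's \<Rightarrow> enat) \<Rightarrow> 's list \<Rightarrow> bool" where
  "reduced S M w \<longleftrightarrow> w \<in> lists S \<and>
    (\<forall>v\<in>lists S. length v < length w \<longrightarrow> word_elt S M v \<noteq> word_elt S M w)"

fun alt_word :: "nat \<Rightarrow> 's \<Rightarrow> 's \<Rightarrow> 's list" where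
  "alt_word 0 s t = []"
| "alt_word (Suc n) s t = s # alt_word n t s"

lemma relator_lists:
  "s \<in> S \<Longrightarrow> t \<in> S \<Longrightarrow> concat (replicate n [(s, True), (t, True)]) \<in> lists (S \<times> UNIV)"
  by (induction n) simp_all

lemma cox_eq_lists: "cox_eq S M v w \<Longrightarrow> v \<in> lists (S \<times> UNIV) \<and> w \<in> lists (S \<times> UNIV)"
proof (induction rule: cox_eq.induct)
  case (cancel u v s b)
  then show ?case by simp
next
  case (relator u v s t)
  then show ?case by (simp only: append_in_lists_conv relator_lists simp_thms)
qed blast+

lemma cox_eq_append_right:
  "cox_eq S M v w \<Longrightarrow> x \<in> lists (S \<times> UNIV) \<Longrightarrow> cox_eq S M (v @ x) (w @ x)"
proof (induction rule: cox_eq.induct)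
  case (cancel u v s b)
  then show ?case using cox_eq.cancel[of u S "v @ x" s M b] by simp
next
  case (relator u v s t)
  then show ?case using cox_eq.relator[of u S "v @ x" s t M] by simp
next
  case (refl w)
  then show ?case by (simp add: cox_eq.refl)
next
  case (sym v w)
  then show ?case by (blast intro: cox_eq.sym)
next
  case (trans u v w)
  then show ?case using cox_eq.trans by metis
qed

lemma cox_eq_append_left:
  "cox_eq S M v w \<Longrightarrow> x \<in> lists (S \<times> UNIV) \<Longrightarrow> cox_eq S M (x @ v) (x @ w)"
proof (induction rule: cox_eq.induct)
  case (cancel u v s b)
  then show ?case using cox_eq.cancel[of "x @ u" S v s M b] by simp
next
  case (relator u v s t)
  then show ?case using cox_eq.relator[of "x @ u" S v s t M] by simp
next
  case (refl w)
  then show ?case by (simp add: cox_eq.refl)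
next
  case (sym v w)
  then show ?case by (blast intro: cox_eq.sym)
next
  case (trans u v w)
  then show ?case using cox_eq.trans by metis
qed

lemma equiv_cox_rel: "equiv (lists (S \<times> UNIV)) (cox_rel S M)"
proof (rule equivI)
  show "cox_rel S M \<subseteq> lists (S \<times> UNIV) \<times> lists (S \<times> UNIV)"
    unfolding cox_rel_def using cox_eq_lists by blast
  show "refl_on (lists (S \<times> UNIV)) (cox_rel S M)"
    by (rule refl_onI) (simp add: cox_rel_def cox_eq.refl)
  show "Relation.sym (cox_rel S M)"
    by (rule symI) (unfold cox_rel_def mem_Collect_eq case_prod_conv, rule cox_eq.sym)
  show "Relation.trans (cox_rel S M)"
    by (rule transI) (unfold cox_rel_def mem_Collect_eq case_prod_conv, rule cox_eq.trans)
qed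

lemma coxeter_mult_class:
  assumes "v \<in> lists (S \<times> UNIV)" "w \<in> lists (S \<times> UNIV)"
  shows "(cox_rel S M `` {v}) \<otimes>\<^bsub>coxeter_group S M\<^esub> (cox_rel S M `` {w}) = cox_rel S M `` {v @ w}"
proof -
  have *: "cox_rel S M `` {a @ b} = cox_rel S M `` {v @ w}"
    if "a \<in> cox_rel S M `` {v}" "b \<in> cox_rel S M `` {w}" for a b
  proof -
    have "cox_eq S M v a" "cox_eq S M w b" using that by (auto simp: cox_rel_def)
    then have "cox_eq S M (v @ w) (a @ b)"
      using assms cox_eq_append_left[of S M w b v] cox_eq_append_right[of S M v a b]
        cox_eq_lists[of S M w b] cox_eq.trans[of S M "v @ w" "v @ b" "a @ b"] by blast
    then have "cox_rel S M `` {v @ w} = cox_rel S M `` {a @ b}"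
      by (intro equiv_class_eq[OF equiv_cox_rel]) (simp add: cox_rel_def)
    then show ?thesis by (rule HOL.sym)
  qed
  have "v \<in> cox_rel S M `` {v}" "w \<in> cox_rel S M `` {w}"
    using assms by (auto simp: cox_rel_def intro: cox_eq.refl)
  then show ?thesis
    unfolding coxeter_group_def by (simp, use * in blast)
qed

lemma signed_word_inverse:
  "v \<in> lists (S \<times> UNIV) \<Longrightarrow> cox_eq S M (rev (map (\<lambda>(s, b). (s, \<not> b)) v) @ v) []"
proof (induction v)
  case Nil
  then show ?case by (auto intro: cox_eq.refl)
next
  case (Cons a v)
  obtain s b where a: "a = (s, b)" by force
  let ?u = "rev (map (\<lambda>(s, b). (s, \<not> b)) v)"
  have "?u \<in> lists (S \<times> UNIV)" using Cons.prems by (auto simp: in_lists_conv_set)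
  then have "cox_eq S M (?u @ [(s, \<not> b), (s, \<not> \<not> b)] @ v) (?u @ v)"
    using Cons.prems a by (intro cox_eq.cancel) auto
  moreover have "cox_eq S M (?u @ v) []"
    using Cons by simp
  ultimately show ?case using a cox_eq.trans[of S M "?u @ [(s, \<not> b), (s, \<not> \<not> b)] @ v" "?u @ v" "[]"] by simp
qed

lemma group_coxeter_group: "group (coxeter_group S M)"
proof (rule groupI)
  let ?G = "coxeter_group S M"
  let ?L = "lists (S \<times> (UNIV :: bool set))"
  have carr: "x \<in> carrier ?G \<longleftrightarrow> (\<exists>v\<in>?L. x = cox_rel S M `` {v})" for x
    by (auto simp: coxeter_group_def quotient_def)
  have one: "\<one>\<^bsub>?G\<^esub> = cox_rel S M `` {[]}" by (simp add: coxeter_group_def)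
  show "\<one>\<^bsub>?G\<^esub> \<in> carrier ?G" unfolding one carr by blast
  show "x \<otimes>\<^bsub>?G\<^esub> y \<in> carrier ?G" if xy: "x \<in> carrier ?G" "y \<in> carrier ?G" for x y
  proof -
    obtain a b where ab: "a \<in> ?L" "b \<in> ?L" "x = cox_rel S M `` {a}" "y = cox_rel S M `` {b}"
      using xy unfolding carr by blast
    then have "a @ b \<in> ?L" by simp
    then show ?thesis unfolding carr ab(3,4) coxeter_mult_class[OF ab(1,2)] by blast
  qed
  show "x \<otimes>\<^bsub>?G\<^esub> y \<otimes>\<^bsub>?G\<^esub> z = x \<otimes>\<^bsub>?G\<^esub> (y \<otimes>\<^bsub>?G\<^esub> z)"
    if xyz: "x \<in> carrier ?G" "y \<in> carrier ?G" "z \<in> carrier ?G" for x y z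
  proof -
    obtain a b c where "a \<in> ?L" "b \<in> ?L" "c \<in> ?L" "x = cox_rel S M `` {a}"
      "y = cox_rel S M `` {b}" "z = cox_rel S M `` {c}"
      using xyz unfolding carr by blast
    then show ?thesis by (simp add: coxeter_mult_class)
  qed
  show "\<one>\<^bsub>?G\<^esub> \<otimes>\<^bsub>?G\<^esub> x = x" if x: "x \<in> carrier ?G" for x
  proof -
    obtain v where v: "v \<in> ?L" "x = cox_rel S M `` {v}" using x unfolding carr by blast
    then show ?thesis using coxeter_mult_class[of "[]" S v M] unfolding one by simp
  qed
  show "\<exists>y\<in>carrier ?G. y \<otimes>\<^bsub>?G\<^esub> x = \<one>\<^bsub>?G\<^esub>" if x: "x \<in> carrier ?G" for x
  proof -
    obtain v where v: "v \<in> ?L" "x = cox_rel S M `` {v}" using x unfolding carr by blast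
    let ?u = "rev (map (\<lambda>(s, b). (s, \<not> b)) v)"
    have u: "?u \<in> ?L" using v by (auto simp: in_lists_conv_set)
    have "cox_rel S M `` {?u @ v} = cox_rel S M `` {[]}"
      using signed_word_inverse[OF v(1)]
      by (intro equiv_class_eq[OF equiv_cox_rel]) (simp add: cox_rel_def)
    then have "(cox_rel S M `` {?u}) \<otimes>\<^bsub>?G\<^esub> x = \<one>\<^bsub>?G\<^esub>"
      unfolding one v(2) coxeter_mult_class[OF u v(1)] .
    moreover have "cox_rel S M `` {?u} \<in> carrier ?G" unfolding carr using u by blast
    ultimately show ?thesis by blast
  qed
qed

section \<open>Groupoids\<close>

text \<open>\<open>cmp G g h\<close> is the composite \<open>g;h\<close> (first \<open>g\<close>, then \<open>h\<close>). The values of the operations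
  outside \<open>vert G\<close> and \<open>arr G\<close> carry no meaning.\<close>

record ('v, 'a) groupoid =
  vert :: "'v set"
  arr :: "'a set"
  ini :: "'a \<Rightarrow> 'v"
  ter :: "'a \<Rightarrow> 'v"
  idn :: "'v \<Rightarrow> 'a"
  ivs :: "'a \<Rightarrow> 'a"
  cmp :: "'a \<Rightarrow> 'a \<Rightarrow> 'a"

locale groupoid =
  fixes G :: "('v, 'a) groupoid"
  assumes nonempty: "vert G \<noteq> {}"
    and ini_vert: "g \<in> arr G \<Longrightarrow> ini G g \<in> vert G"
    and ter_vert: "g \<in> arr G \<Longrightarrow> ter G g \<in> vert G"
    and idn_arr: "v \<in> vert G \<Longrightarrow> idn G v \<in> arr G"
    and ini_idn: "v \<in> vert G \<Longrightarrow> ini G (idn G v) = v"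
    and ter_idn: "v \<in> vert G \<Longrightarrow> ter G (idn G v) = v"
    and cmp_arr: "g \<in> arr G \<Longrightarrow> h \<in> arr G \<Longrightarrow> ter G g = ini G h \<Longrightarrow> cmp G g h \<in> arr G"
    and ini_cmp: "g \<in> arr G \<Longrightarrow> h \<in> arr G \<Longrightarrow> ter G g = ini G h \<Longrightarrow> ini G (cmp G g h) = ini G g"
    and ter_cmp: "g \<in> arr G \<Longrightarrow> h \<in> arr G \<Longrightarrow> ter G g = ini G h \<Longrightarrow> ter G (cmp G g h) = ter G h"
    and cmp_assoc: "g \<in> arr G \<Longrightarrow> h \<in> arr G \<Longrightarrow> k \<in> arr G \<Longrightarrow> ter G g = ini G h \<Longrightarrow> ter G h = ini G k \<Longrightarrow>
      cmp G (cmp G g h) k = cmp G g (cmp G h k)"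
    and cmp_idn_left: "g \<in> arr G \<Longrightarrow> cmp G (idn G (ini G g)) g = g"
    and cmp_idn_right: "g \<in> arr G \<Longrightarrow> cmp G g (idn G (ter G g)) = g"
    and ivs_arr: "g \<in> arr G \<Longrightarrow> ivs G g \<in> arr G"
    and ini_ivs: "g \<in> arr G \<Longrightarrow> ini G (ivs G g) = ter G g"
    and ter_ivs: "g \<in> arr G \<Longrightarrow> ter G (ivs G g) = ini G g"
    and cmp_ivs_right: "g \<in> arr G \<Longrightarrow> cmp G g (ivs G g) = idn G (ini G g)"
    and cmp_ivs_left: "g \<in> arr G \<Longrightarrow> cmp G (ivs G g) g = idn G (ter G g)"

text \<open>In a groupoid two vertices are connected iff a single arrow joins them.\<close>

definition component :: "('v, 'a) groupoid \<Rightarrow> 'v \<Rightarrow> ('v, 'a) groupoid" where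
  "component G v =
    (let V = {w. \<exists>g\<in>arr G. ini G g = v \<and> ter G g = w}
     in G\<lparr> vert := V, arr := {g \<in> arr G. ini G g \<in> V \<and> ter G g \<in> V} \<rparr>)"

definition trivial_groupoid :: "('v, 'a) groupoid \<Rightarrow> bool" where
  "trivial_groupoid G \<longleftrightarrow> card (vert G) = 1 \<and> card (arr G) = 1"

section \<open>Generalized chamber systems and Weyl data\<close>

text \<open>An edge is stored together with its type, so edges of different types are distinct; a gallery
  is stored as its initial chamber together with its list of edges, so that trivial galleries are
  the pairs \<open>(C, [])\<close>.\<close>

type_synonym ('s, 'e) edge = "'s \<times> 'e"
type_synonym ('s, 'c, 'e) gallery = "'c \<times> ('s, 'e) edge list"

record ('s, 'c, 'e) chamber_system =
  chambers :: "'c set"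
  panel_groupoid :: "'s \<Rightarrow> ('c, 'e) groupoid"

record ('s, 'c, 'e) weyl_data = "('s, 'c, 'e) chamber_system" +
  defining_suites :: "'s \<Rightarrow> 's \<Rightarrow> ('s, 'c, 'e) gallery set"

definition chamber_system :: "'s set \<Rightarrow> ('s, 'c, 'e, 'z) chamber_system_scheme \<Rightarrow> bool" where
  "chamber_system S W \<longleftrightarrow>
    (\<forall>s\<in>S. groupoid (panel_groupoid W s) \<and> vert (panel_groupoid W s) = chambers W)"

definition edges :: "'s set \<Rightarrow> ('s, 'c, 'e, 'z) chamber_system_scheme \<Rightarrow> ('s, 'e) edge set" where
  "edges S W =
    {(s, e). s \<in> S \<and> e \<in> arr (panel_groupoid W s) \<and> e \<notin> idn (panel_groupoid W s) ` chambers W}"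

definition edge_ini :: "('s, 'c, 'e, 'z) chamber_system_scheme \<Rightarrow> ('s, 'e) edge \<Rightarrow> 'c" where
  "edge_ini W i = ini (panel_groupoid W (fst i)) (snd i)"

definition edge_ter :: "('s, 'c, 'e, 'z) chamber_system_scheme \<Rightarrow> ('s, 'e) edge \<Rightarrow> 'c" where
  "edge_ter W i = ter (panel_groupoid W (fst i)) (snd i)"

definition edge_inv :: "('s, 'c, 'e, 'z) chamber_system_scheme \<Rightarrow> ('s, 'e) edge \<Rightarrow> ('s, 'e) edge" where
  "edge_inv W i = (fst i, ivs (panel_groupoid W (fst i)) (snd i))"

text \<open>Only meaningful for consecutive edges of the same type.\<close>

definition edge_cmp ::
    "('s, 'c, 'e, 'z) chamber_system_scheme \<Rightarrow> ('s, 'e) edge \<Rightarrow> ('s, 'e) edge \<Rightarrow> ('s, 'e) edge" where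
  "edge_cmp W i j = (fst i, cmp (panel_groupoid W (fst i)) (snd i) (snd j))"

text \<open>Composable edges of the same type whose composite is again an edge (not an identity).\<close>

definition composable ::
    "'s set \<Rightarrow> ('s, 'c, 'e, 'z) chamber_system_scheme \<Rightarrow> ('s, 'e) edge \<Rightarrow> ('s, 'e) edge \<Rightarrow> bool" where
  "composable S W i j \<longleftrightarrow> i \<in> edges S W \<and> j \<in> edges S W \<and>
    fst i = fst j \<and> edge_ter W i = edge_ini W j \<and> j \<noteq> edge_inv W i"

fun consecutive :: "'s set \<Rightarrow> ('s, 'c, 'e, 'z) chamber_system_scheme \<Rightarrow> 'c \<Rightarrow> ('s, 'e) edge list \<Rightarrow> bool" where
  "consecutive S W C [] \<longleftrightarrow> True"
| "consecutive S W C (i # is) \<longleftrightarrow>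
    i \<in> edges S W \<and> edge_ini W i = C \<and> consecutive S W (edge_ter W i) is"

definition gallery :: "'s set \<Rightarrow> ('s, 'c, 'e, 'z) chamber_system_scheme \<Rightarrow> ('s, 'c, 'e) gallery \<Rightarrow> bool" where
  "gallery S W \<beta> \<longleftrightarrow> fst \<beta> \<in> chambers W \<and> consecutive S W (fst \<beta>) (snd \<beta>)"

definition gal_ini :: "('s, 'c, 'e) gallery \<Rightarrow> 'c" where
  "gal_ini \<beta> = fst \<beta>"

definition gal_ter :: "('s, 'c, 'e, 'z) chamber_system_scheme \<Rightarrow> ('s, 'c, 'e) gallery \<Rightarrow> 'c" where
  "gal_ter W \<beta> = (if snd \<beta> = [] then fst \<beta> else edge_ter W (last (snd \<beta>)))"

definition gal_type :: "('s, 'c, 'e) gallery \<Rightarrow> 's list" where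
  "gal_type \<beta> = map fst (snd \<beta>)"

definition gal_length :: "'s set \<Rightarrow> ('s \<Rightarrow> 's \<Rightarrow> enat) \<Rightarrow> ('s, 'c, 'e) gallery \<Rightarrow> ('s \<times> bool) list set" where
  "gal_length S M \<beta> = word_elt S M (gal_type \<beta>)"

definition gal_cycle :: "'s set \<Rightarrow> ('s, 'c, 'e, 'z) chamber_system_scheme \<Rightarrow> ('s, 'c, 'e) gallery \<Rightarrow> bool" where
  "gal_cycle S W \<beta> \<longleftrightarrow> gallery S W \<beta> \<and> gal_ini \<beta> = gal_ter W \<beta>"

definition geodesic ::
    "'s set \<Rightarrow> ('s \<Rightarrow> 's \<Rightarrow> enat) \<Rightarrow> ('s, 'c, 'e, 'z) chamber_system_scheme \<Rightarrow> ('s, 'c, 'e) gallery \<Rightarrow> bool" where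
  "geodesic S M W \<beta> \<longleftrightarrow> gallery S W \<beta> \<and> reduced S M (gal_type \<beta>)"

definition finite_pair :: "'s set \<Rightarrow> ('s \<Rightarrow> 's \<Rightarrow> enat) \<Rightarrow> 's \<Rightarrow> 's \<Rightarrow> bool" where
  "finite_pair S M s t \<longleftrightarrow> s \<in> S \<and> t \<in> S \<and> s \<noteq> t \<and> M s t \<noteq> \<infinity>"

definition max_geodesic ::
    "'s set \<Rightarrow> ('s \<Rightarrow> 's \<Rightarrow> enat) \<Rightarrow> ('s, 'c, 'e, 'z) chamber_system_scheme \<Rightarrow> 's \<Rightarrow> 's \<Rightarrow>
      ('s, 'c, 'e) gallery \<Rightarrow> bool" where
  "max_geodesic S M W s t \<beta> \<longleftrightarrow>
    gallery S W \<beta> \<and> gal_type \<beta> = alt_word (the_enat (M s t)) s t"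

definition st_cycle ::
    "'s set \<Rightarrow> ('s \<Rightarrow> 's \<Rightarrow> enat) \<Rightarrow> ('s, 'c, 'e, 'z) chamber_system_scheme \<Rightarrow> 's \<Rightarrow> 's \<Rightarrow>
      ('s, 'c, 'e) gallery \<Rightarrow> bool" where
  "st_cycle S M W s t \<beta> \<longleftrightarrow>
    gal_cycle S W \<beta> \<and> gal_type \<beta> = alt_word (2 * the_enat (M s t)) s t"

definition weyl_data :: "'s set \<Rightarrow> ('s \<Rightarrow> 's \<Rightarrow> enat) \<Rightarrow> ('s, 'c, 'e) weyl_data \<Rightarrow> bool" where
  "weyl_data S M W \<longleftrightarrow> chamber_system S W \<and>
    (\<forall>s t. finite_pair S M s t \<longrightarrow> (\<forall>\<beta>\<in>defining_suites W s t. st_cycle S M W s t \<beta>))"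

definition defining_suite ::
    "'s set \<Rightarrow> ('s \<Rightarrow> 's \<Rightarrow> enat) \<Rightarrow> ('s, 'c, 'e) weyl_data \<Rightarrow> ('s, 'c, 'e) gallery \<Rightarrow> bool" where
  "defining_suite S M W \<beta> \<longleftrightarrow> (\<exists>s t. finite_pair S M s t \<and> \<beta> \<in> defining_suites W s t)"

section \<open>Homotopy\<close>

inductive elem_homotopy ::
    "'s set \<Rightarrow> ('s \<Rightarrow> 's \<Rightarrow> enat) \<Rightarrow> ('s, 'c, 'e) weyl_data \<Rightarrow>
      ('s, 'c, 'e) gallery \<Rightarrow> ('s, 'c, 'e) gallery \<Rightarrow> bool"
  for S M W where
  delete_inverse: "gallery S W (C, a @ [i, edge_inv W i] @ b) \<Longrightarrow>
    elem_homotopy S M W (C, a @ [i, edge_inv W i] @ b) (C, a @ b)"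
| compose: "gallery S W (C, a @ [i, j] @ b) \<Longrightarrow> composable S W i j \<Longrightarrow>
    elem_homotopy S M W (C, a @ [i, j] @ b) (C, a @ [edge_cmp W i j] @ b)"
| delete_suite: "gallery S W (C, a @ c @ b) \<Longrightarrow> defining_suite S M W (gal_ter W (C, a), c) \<Longrightarrow>
    elem_homotopy S M W (C, a @ c @ b) (C, a @ b)"

definition homotopic ::
    "'s set \<Rightarrow> ('s \<Rightarrow> 's \<Rightarrow> enat) \<Rightarrow> ('s, 'c, 'e) weyl_data \<Rightarrow>
      ('s, 'c, 'e) gallery \<Rightarrow> ('s, 'c, 'e) gallery \<Rightarrow> bool" where
  "homotopic S M W \<beta> \<gamma> \<longleftrightarrow>
    gallery S W \<beta> \<and> gallery S W \<gamma> \<and> equivclp (elem_homotopy S M W) \<beta> \<gamma>"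

definition suite ::
    "'s set \<Rightarrow> ('s \<Rightarrow> 's \<Rightarrow> enat) \<Rightarrow> ('s, 'c, 'e) weyl_data \<Rightarrow> ('s, 'c, 'e) gallery \<Rightarrow> bool" where
  "suite S M W \<beta> \<longleftrightarrow>
    (\<exists>s t. finite_pair S M s t \<and> st_cycle S M W s t \<beta>) \<and> (\<exists>C. homotopic S M W \<beta> (C, []))"

section \<open>Morphisms and coverings\<close>

definition gallery_map ::
    "('c \<Rightarrow> 'd) \<Rightarrow> (('s, 'e) edge \<Rightarrow> ('s, 'f) edge) \<Rightarrow> ('s, 'c, 'e) gallery \<Rightarrow> ('s, 'd, 'f) gallery" where
  "gallery_map \<phi> \<epsilon> \<beta> = (\<phi> (fst \<beta>), map \<epsilon> (snd \<beta>))"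

text \<open>A morphism consists of a map \<open>\<phi>\<close> on chambers and a map \<open>\<epsilon>\<close> on edges.\<close>

definition chamber_morphism ::
    "'s set \<Rightarrow> ('s, 'c, 'e, 'y) chamber_system_scheme \<Rightarrow> ('s, 'd, 'f, 'z) chamber_system_scheme \<Rightarrow>
      ('c \<Rightarrow> 'd) \<Rightarrow> (('s, 'e) edge \<Rightarrow> ('s, 'f) edge) \<Rightarrow> bool" where
  "chamber_morphism S V W \<phi> \<epsilon> \<longleftrightarrow>
    (\<forall>C\<in>chambers V. \<phi> C \<in> chambers W) \<and>
    (\<forall>i\<in>edges S V. \<epsilon> i \<in> edges S W \<and> fst (\<epsilon> i) = fst i \<and>
       edge_ini W (\<epsilon> i) = \<phi> (edge_ini V i) \<and> edge_ter W (\<epsilon> i) = \<phi> (edge_ter V i) \<and>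
       \<epsilon> (edge_inv V i) = edge_inv W (\<epsilon> i)) \<and>
    (\<forall>i j. composable S V i j \<longrightarrow> \<epsilon> (edge_cmp V i j) = edge_cmp W (\<epsilon> i) (\<epsilon> j))"

definition weyl_morphism ::
    "'s set \<Rightarrow> ('s \<Rightarrow> 's \<Rightarrow> enat) \<Rightarrow> ('s, 'c, 'e) weyl_data \<Rightarrow> ('s, 'd, 'f) weyl_data \<Rightarrow>
      ('c \<Rightarrow> 'd) \<Rightarrow> (('s, 'e) edge \<Rightarrow> ('s, 'f) edge) \<Rightarrow> bool" where
  "weyl_morphism S M V W \<phi> \<epsilon> \<longleftrightarrow> chamber_morphism S V W \<phi> \<epsilon> \<and>
    (\<forall>\<beta>. defining_suite S M V \<beta> \<longrightarrow> suite S M W (gallery_map \<phi> \<epsilon> \<beta>))"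

definition surjective_etale ::
    "'s set \<Rightarrow> ('s, 'c, 'e, 'y) chamber_system_scheme \<Rightarrow> ('s, 'd, 'f, 'z) chamber_system_scheme \<Rightarrow>
      ('c \<Rightarrow> 'd) \<Rightarrow> (('s, 'e) edge \<Rightarrow> ('s, 'f) edge) \<Rightarrow> bool" where
  "surjective_etale S V W \<phi> \<epsilon> \<longleftrightarrow> chamber_morphism S V W \<phi> \<epsilon> \<and>
    \<phi> ` chambers V = chambers W \<and>
    (\<forall>C\<in>chambers V.
       bij_betw \<epsilon> {i \<in> edges S V. edge_ini V i = C} {i \<in> edges S W. edge_ini W i = \<phi> C})"

definition covering ::
    "'s set \<Rightarrow> ('s \<Rightarrow> 's \<Rightarrow> enat) \<Rightarrow> ('s, 'c, 'e) weyl_data \<Rightarrow> ('s, 'd, 'f) weyl_data \<Rightarrow>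
      ('c \<Rightarrow> 'd) \<Rightarrow> (('s, 'e) edge \<Rightarrow> ('s, 'f) edge) \<Rightarrow> bool" where
  "covering S M V W \<phi> \<epsilon> \<longleftrightarrow>
    weyl_data S M V \<and> weyl_data S M W \<and>
    weyl_morphism S M V W \<phi> \<epsilon> \<and> surjective_etale S V W \<phi> \<epsilon> \<and>
    (\<forall>\<beta>. gallery S V \<beta> \<and> defining_suite S M W (gallery_map \<phi> \<epsilon> \<beta>) \<longrightarrow> suite S M V \<beta>)"

section \<open>Weyl graphs\<close>

definition pre_weyl_graph :: "'s set \<Rightarrow> ('s \<Rightarrow> 's \<Rightarrow> enat) \<Rightarrow> ('s, 'c, 'e) weyl_data \<Rightarrow> bool" where
  "pre_weyl_graph S M W \<longleftrightarrow> weyl_data S M W \<and>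
    (\<forall>s\<in>S. \<forall>C\<in>chambers W. \<not> trivial_groupoid (component (panel_groupoid W s) C)) \<and>
    (\<forall>s t \<beta>. finite_pair S M s t \<and> max_geodesic S M W s t \<beta> \<longrightarrow>
       (\<exists>\<gamma>. max_geodesic S M W t s \<gamma> \<and> homotopic S M W \<beta> \<gamma>))"

definition weyl_graph :: "'s set \<Rightarrow> ('s \<Rightarrow> 's \<Rightarrow> enat) \<Rightarrow> ('s, 'c, 'e) weyl_data \<Rightarrow> bool" where
  "weyl_graph S M W \<longleftrightarrow> pre_weyl_graph S M W \<and>
    (\<forall>\<beta> \<gamma>. geodesic S M W \<beta> \<and> geodesic S M W \<gamma> \<and> homotopic S M W \<beta> \<gamma> \<longrightarrow>
       gal_length S M \<beta> = gal_length S M \<gamma>)"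

end

theory Submission imports Defs begin

text \<open>Galleries lift uniquely through a covering once the initial chamber is chosen, and homotopies
  project as well as lift: a defining suite upstairs projects to a suite, and a lift of a defining
  suite is a suite, hence is null-homotopic and in particular closed. The conditions PW1 and W only
  involve galleries, their types and homotopy, so each of them transfers in both directions. The
  panel condition PW0 says that every chamber has an issuing edge of each type, which an etale
  surjection preserves and reflects.\<close>

section \<open>Chamber systems and galleries\<close>

lemma gal_ter_Nil [simp]: "gal_ter W (C, []) = C"
  by (simp add: gal_ter_def)

text \<open>Trades the access to the last edge for a recursion from the initial chamber, so that
  terminal chambers can be computed along the same induction as \<open>consecutive\<close>.\<close>

lemma gal_ter_Cons [simp]: "gal_ter W (C, i # is) = gal_ter W (edge_ter W i, is)"
  by (simp add: gal_ter_def)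

lemma gal_ter_append [simp]: "gal_ter W (C, a @ b) = gal_ter W (gal_ter W (C, a), b)"
  by (induction a arbitrary: C) simp_all

lemma consecutive_append [simp]:
  "consecutive S W C (a @ b) \<longleftrightarrow> consecutive S W C a \<and> consecutive S W (gal_ter W (C, a)) b"
  by (induction a arbitrary: C) auto

lemma gallery_Pair [simp]: "gallery S W (C, a) \<longleftrightarrow> C \<in> chambers W \<and> consecutive S W C a"
  by (simp add: gallery_def)

locale chamber_sys =
  fixes S :: "'s set" and W :: "('s, 'c, 'e, 'z) chamber_system_scheme"
  assumes chamber_system: "chamber_system S W"
begin

lemma panel: "s \<in> S \<Longrightarrow> groupoid (panel_groupoid W s)"
  and vert_panel: "s \<in> S \<Longrightarrow> vert (panel_groupoid W s) = chambers W"
  using chamber_system by (auto simp: chamber_system_def)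

lemma edge_ter_chamber: "i \<in> edges S W \<Longrightarrow> edge_ter W i \<in> chambers W"
  using groupoid.ter_vert[OF panel] by (auto simp: edges_def edge_ter_def vert_panel)

lemma gal_ter_chamber: "C \<in> chambers W \<Longrightarrow> consecutive S W C a \<Longrightarrow> gal_ter W (C, a) \<in> chambers W"
  by (induction a arbitrary: C) (auto simp: edge_ter_chamber)

text \<open>Edges are non-identity arrows, so the point is that inversion creates no identity: if
  the inverse of \<open>e\<close> were one, then \<open>e\<close>, composed with it on the right,
  would be both \<open>e\<close> and the identity at its initial vertex.\<close>

lemma edge_inv:
  assumes "i \<in> edges S W"
  shows "edge_inv W i \<in> edges S W"
    and "edge_ini W (edge_inv W i) = edge_ter W i" and "edge_ter W (edge_inv W i) = edge_ini W i"
proof -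
  obtain s e where i: "i = (s, e)" by force
  let ?G = "panel_groupoid W s"
  have s: "s \<in> S" and e: "e \<in> arr ?G" and ne: "e \<notin> idn ?G ` chambers W"
    using assms by (auto simp: edges_def i)
  interpret groupoid ?G using panel[OF s] .
  have "ivs ?G e \<noteq> idn ?G v" if v: "v \<in> chambers W" for v
  proof
    assume *: "ivs ?G e = idn ?G v"
    then have "v = ter ?G e" using ini_ivs[OF e] ini_idn[of v] v vert_panel[OF s] by simp
    then have "idn ?G (ini ?G e) = e" using * cmp_ivs_right[OF e] cmp_idn_right[OF e] by simp
    then show False using ne ini_vert[OF e] vert_panel[OF s] by force
  qed
  then show "edge_inv W i \<in> edges S W" using s ivs_arr[OF e] by (auto simp: edges_def edge_inv_def i)
  show "edge_ini W (edge_inv W i) = edge_ter W i" "edge_ter W (edge_inv W i) = edge_ini W i"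
    using ini_ivs[OF e] ter_ivs[OF e] by (auto simp: edge_ini_def edge_ter_def edge_inv_def i)
qed

text \<open>If the composite of \<open>e\<close> and \<open>f\<close> were an identity, cancelling
  \<open>e\<close> on the left would make \<open>f\<close> its inverse, which
  \<open>composable\<close> excludes.\<close>

lemma edge_cmp:
  assumes "composable S W i j"
  shows "edge_cmp W i j \<in> edges S W"
    and "edge_ini W (edge_cmp W i j) = edge_ini W i" and "edge_ter W (edge_cmp W i j) = edge_ter W j"
proof -
  obtain s e f where i: "i = (s, e)" and j: "j = (s, f)"
    using assms by (cases i, cases j) (auto simp: composable_def)
  let ?G = "panel_groupoid W s"
  have s: "s \<in> S" and e: "e \<in> arr ?G" and f: "f \<in> arr ?G" and ef: "ter ?G e = ini ?G f"
    and ne: "f \<noteq> ivs ?G e"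
    using assms by (auto simp: edges_def i j composable_def edge_ini_def edge_ter_def edge_inv_def)
  interpret groupoid ?G using panel[OF s] .
  have "cmp ?G e f \<noteq> idn ?G v" if v: "v \<in> chambers W" for v
  proof
    assume *: "cmp ?G e f = idn ?G v"
    have v': "v = ini ?G e" using * ini_cmp[OF e f ef] ini_idn[of v] v vert_panel[OF s] by simp
    have "f = cmp ?G (cmp ?G (ivs ?G e) e) f"
      using cmp_ivs_left[OF e] cmp_idn_left[OF f] ef by simp
    also have "\<dots> = cmp ?G (ivs ?G e) (idn ?G v)"
      using cmp_assoc[OF ivs_arr[OF e] e f] ter_ivs[OF e] ef * by simp
    also have "\<dots> = ivs ?G e"
      using cmp_idn_right[OF ivs_arr[OF e]] ter_ivs[OF e] v' by simp
    finally show False using ne by simp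
  qed
  then show "edge_cmp W i j \<in> edges S W"
    using s cmp_arr[OF e f ef] by (auto simp: edges_def edge_cmp_def i j)
  show "edge_ini W (edge_cmp W i j) = edge_ini W i" "edge_ter W (edge_cmp W i j) = edge_ter W j"
    using ini_cmp[OF e f ef] ter_cmp[OF e f ef]
    by (auto simp: edge_ini_def edge_ter_def edge_cmp_def i j)
qed

text \<open>Turns PW0 into a condition on the edges issuing from a chamber, the only local data that
  an etale map controls. If the identity is the only arrow from \<open>C\<close>, then no other
  vertex is reachable and the component contains no further arrow.\<close>

lemma trivial_panel_iff:
  assumes s: "s \<in> S" and C: "C \<in> chambers W"
  shows "trivial_groupoid (component (panel_groupoid W s) C) \<longleftrightarrow>
    \<not> (\<exists>i\<in>edges S W. fst i = s \<and> edge_ini W i = C)"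
proof -
  let ?G = "panel_groupoid W s"
  interpret groupoid ?G using panel[OF s] .
  define V where "V = {w. \<exists>g\<in>arr ?G. ini ?G g = C \<and> ter ?G g = w}"
  define A where "A = {g \<in> arr ?G. ini ?G g \<in> V \<and> ter ?G g \<in> V}"
  have triv: "trivial_groupoid (component ?G C) \<longleftrightarrow> card V = 1 \<and> card A = 1"
    by (simp add: trivial_groupoid_def component_def Let_def V_def[symmetric] A_def[symmetric])
  have CV: "C \<in> vert ?G" using C vert_panel[OF s] by simp
  have C_V: "C \<in> V" unfolding V_def using idn_arr[OF CV] ini_idn[OF CV] ter_idn[OF CV] by blast
  have idA: "idn ?G C \<in> A"
    unfolding A_def using idn_arr[OF CV] ini_idn[OF CV] ter_idn[OF CV] C_V by simp
  show ?thesis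
  proof
    assume "trivial_groupoid (component ?G C)"
    then have A1: "A = {idn ?G C}" using triv idA by (metis card_1_singletonE singletonD)
    show "\<not> (\<exists>i\<in>edges S W. fst i = s \<and> edge_ini W i = C)"
    proof
      assume "\<exists>i\<in>edges S W. fst i = s \<and> edge_ini W i = C"
      then obtain e where e: "e \<in> arr ?G" "e \<notin> idn ?G ` chambers W" "ini ?G e = C"
        by (auto simp: edges_def edge_ini_def)
      then have "e \<in> A" unfolding A_def using C_V by (auto simp: V_def)
      then show False using A1 e C by auto
    qed
  next
    assume no: "\<not> (\<exists>i\<in>edges S W. fst i = s \<and> edge_ini W i = C)"
    have id: "g = idn ?G C" if g: "g \<in> arr ?G" "ini ?G g = C" for g
    proof -
      have "(s, g) \<notin> edges S W" using no g by (force simp: edge_ini_def)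
      then obtain v where "v \<in> chambers W" "g = idn ?G v" using s g by (auto simp: edges_def)
      then show ?thesis using g ini_idn[of v] vert_panel[OF s] by simp
    qed
    have "V = {C}" using C_V ter_idn[OF CV] id by (auto simp: V_def)
    moreover have "A = {idn ?G C}" using idA id \<open>V = {C}\<close> by (auto simp: A_def)
    ultimately show "trivial_groupoid (component ?G C)" using triv by simp
  qed
qed

end

section \<open>Homotopy\<close>

locale weyl_sys =
  fixes S :: "'s set" and M :: "'s \<Rightarrow> 's \<Rightarrow> enat" and W :: "('s, 'c, 'e) weyl_data"
  assumes weyl_data: "weyl_data S M W"
begin

sublocale chamber_sys S W
  using weyl_data by unfold_locales (simp add: weyl_data_def)

lemma defining_suite_closed: "defining_suite S M W (C, c) \<Longrightarrow> gal_ter W (C, c) = C"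
  using weyl_data unfolding weyl_data_def defining_suite_def st_cycle_def gal_cycle_def gal_ini_def
  by (metis fst_conv)

text \<open>Inversion and composition respect extremities by the groupoid laws; deleting a defining
  suite keeps the terminal chamber because defining suites are cycles.\<close>

lemma elem_homotopy_invariants:
  "elem_homotopy S M W \<beta> \<gamma> \<Longrightarrow> gallery S W \<beta> \<and> gallery S W \<gamma> \<and>
    fst \<beta> = fst \<gamma> \<and> gal_ter W \<beta> = gal_ter W \<gamma>"
proof (induction rule: elem_homotopy.induct)
  case (delete_inverse C a i b)
  then show ?case using edge_inv[of i] by auto
next
  case (compose C a i j b)
  then show ?case using edge_cmp[of i j] by auto
next
  case (delete_suite C a c b)
  then show ?case using defining_suite_closed by auto
qed

lemma homotopic_refl: "gallery S W \<beta> \<Longrightarrow> homotopic S M W \<beta> \<beta>"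
  by (simp add: homotopic_def)

lemma homotopic_sym: "homotopic S M W \<beta> \<gamma> \<Longrightarrow> homotopic S M W \<gamma> \<beta>"
  by (auto simp: homotopic_def intro: equivclp_sym)

lemma homotopic_trans:
  "homotopic S M W \<alpha> \<beta> \<Longrightarrow> homotopic S M W \<beta> \<gamma> \<Longrightarrow> homotopic S M W \<alpha> \<gamma>"
  by (auto simp: homotopic_def intro: equivclp_trans)

lemma elem_homotopy_homotopic: "elem_homotopy S M W \<beta> \<gamma> \<Longrightarrow> homotopic S M W \<beta> \<gamma>"
  using elem_homotopy_invariants unfolding homotopic_def by blast

text \<open>Each step is an elementary move in either direction. Carrying the homotopy from
  \<open>\<beta>\<close> along keeps all intermediate galleries genuine galleries with the
  extremities of \<open>\<beta>\<close>.\<close>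

lemma homotopic_induct [consumes 1, case_names refl step]:
  assumes "homotopic S M W \<beta> \<gamma>"
    and refl: "P \<beta>"
    and step: "\<And>\<gamma> \<delta>. homotopic S M W \<beta> \<gamma> \<Longrightarrow>
      elem_homotopy S M W \<gamma> \<delta> \<or> elem_homotopy S M W \<delta> \<gamma> \<Longrightarrow> P \<gamma> \<Longrightarrow> P \<delta>"
  shows "P \<gamma>"
proof -
  have "equivclp (elem_homotopy S M W) \<beta> \<gamma>" and g: "gallery S W \<beta>"
    using assms(1) by (auto simp: homotopic_def)
  then have "homotopic S M W \<beta> \<gamma> \<and> P \<gamma>"
  proof (induction rule: equivclp_induct)
    case base
    show ?case using homotopic_refl[OF g] refl by simp
  next
    case (step \<gamma> \<delta>)
    moreover have "homotopic S M W \<gamma> \<delta>"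
      using step.hyps(2) elem_homotopy_homotopic homotopic_sym by blast
    ultimately show ?case using assms(3) homotopic_trans by blast
  qed
  then show ?thesis by simp
qed

lemma homotopic_invariants:
  "homotopic S M W \<beta> \<gamma> \<Longrightarrow> fst \<beta> = fst \<gamma> \<and> gal_ter W \<beta> = gal_ter W \<gamma>"
  by (induction rule: homotopic_induct) (simp, metis elem_homotopy_invariants)

section \<open>Homotopies inside a longer gallery\<close>

lemma elem_homotopy_context:
  assumes "elem_homotopy S M W \<beta> \<gamma>" "gal_ter W (C, a) = fst \<beta>"
    "gallery S W (C, a @ snd \<beta> @ b)"
  shows "elem_homotopy S M W (C, a @ snd \<beta> @ b) (C, a @ snd \<gamma> @ b)"
  using assms
proof (cases rule: elem_homotopy.cases)
  case (delete_inverse D x i y)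
  then show ?thesis
    using assms elem_homotopy.delete_inverse[of S W C "a @ x" i "y @ b" M] by simp
next
  case (compose D x i j y)
  then show ?thesis
    using assms elem_homotopy.compose[of S W C "a @ x" i j "y @ b" M] by simp
next
  case (delete_suite D x c y)
  then show ?thesis
    using assms elem_homotopy.delete_suite[of S W C "a @ x" c "y @ b" M] by simp
qed

lemma homotopic_context:
  assumes "homotopic S M W \<beta> \<gamma>" "gal_ter W (C, a) = fst \<beta>" "gallery S W (C, a @ snd \<beta> @ b)"
  shows "homotopic S M W (C, a @ snd \<beta> @ b) (C, a @ snd \<gamma> @ b)"
  using assms(1)
proof (induction rule: homotopic_induct)
  case refl
  show ?case using homotopic_refl assms(3) .
next
  case (step \<gamma> \<delta>)
  have inv: "gallery S W \<delta>" "fst \<delta> = fst \<gamma>" "gal_ter W \<delta> = gal_ter W \<gamma>"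
    using step.hyps(2) elem_homotopy_invariants[of \<gamma> \<delta>] elem_homotopy_invariants[of \<delta> \<gamma>] by auto
  have gam: "gallery S W (C, a @ snd \<gamma> @ b)" using step.IH by (simp add: homotopic_def)
  have fst: "gal_ter W (C, a) = fst \<gamma>" using homotopic_invariants[OF step.hyps(1)] assms(2) by simp
  \<comment> \<open>The moved middle piece keeps both extremities, so it still fits between
    \<open>a\<close> and \<open>b\<close>.\<close>
  have del: "gallery S W (C, a @ snd \<delta> @ b)"
    using gam inv fst by (cases \<gamma>, cases \<delta>) auto
  have "homotopic S M W (C, a @ snd \<gamma> @ b) (C, a @ snd \<delta> @ b)"
    using step.hyps(2) elem_homotopy_context[of \<gamma> \<delta> C a b] elem_homotopy_context[of \<delta> \<gamma> C a b]
      elem_homotopy_homotopic homotopic_sym gam del fst inv(2) by metis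
  then show ?case using step.IH homotopic_trans by blast
qed

text \<open>Extends the suite move from defining suites to all suites, since a covering and its
  lifts turn defining suites only into suites.\<close>

lemma homotopic_delete_suite:
  assumes "suite S M W (gal_ter W (C, a), c)" "gallery S W (C, a @ c @ b)"
  shows "homotopic S M W (C, a @ c @ b) (C, a @ b)"
proof -
  obtain D where "homotopic S M W (gal_ter W (C, a), c) (D, [])" using assms(1) by (auto simp: suite_def)
  from homotopic_context[OF this, of C a b] show ?thesis using assms(2) by simp
qed

text \<open>Nests the quantifiers so that PW1 appears for a fixed pair of types, the form in which
  \<open>pw1_iff\<close> can rewrite it.\<close>

lemma pre_weyl_graph_alt:
  "pre_weyl_graph S M W \<longleftrightarrow>
    (\<forall>s\<in>S. \<forall>C\<in>chambers W. \<not> trivial_groupoid (component (panel_groupoid W s) C)) \<and>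
    (\<forall>s t. finite_pair S M s t \<longrightarrow> (\<forall>\<beta>. max_geodesic S M W s t \<beta> \<longrightarrow>
      (\<exists>\<gamma>. max_geodesic S M W t s \<gamma> \<and> homotopic S M W \<beta> \<gamma>)))"
  using weyl_data unfolding pre_weyl_graph_def by blast

end

section \<open>Coverings\<close>

locale weyl_covering =
  fixes S :: "'s set" and M :: "'s \<Rightarrow> 's \<Rightarrow> enat"
    and V :: "('s, 'c, 'e) weyl_data" and W :: "('s, 'd, 'f) weyl_data"
    and \<phi> :: "'c \<Rightarrow> 'd" and \<epsilon> :: "('s, 'e) edge \<Rightarrow> ('s, 'f) edge"
  assumes covering: "covering S M V W \<phi> \<epsilon>"
begin

sublocale V: weyl_sys S M V
  using covering by unfold_locales (simp add: covering_def)

sublocale W: weyl_sys S M W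
  using covering by unfold_locales (simp add: covering_def)

abbreviation p :: "('s, 'c, 'e) gallery \<Rightarrow> ('s, 'd, 'f) gallery" where
  "p \<equiv> gallery_map \<phi> \<epsilon>"

section \<open>Edges and galleries under the covering map\<close>

lemma morphism: "chamber_morphism S V W \<phi> \<epsilon>"
  using covering by (simp add: covering_def surjective_etale_def)

lemma chambers_map: "C \<in> chambers V \<Longrightarrow> \<phi> C \<in> chambers W"
  using morphism by (simp add: chamber_morphism_def)

lemma edges_map:
  assumes "i \<in> edges S V"
  shows "\<epsilon> i \<in> edges S W" "fst (\<epsilon> i) = fst i" "edge_ini W (\<epsilon> i) = \<phi> (edge_ini V i)"
    "edge_ter W (\<epsilon> i) = \<phi> (edge_ter V i)" "\<epsilon> (edge_inv V i) = edge_inv W (\<epsilon> i)"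
  using morphism assms by (simp_all add: chamber_morphism_def)

lemma cmp_map: "composable S V i j \<Longrightarrow> \<epsilon> (edge_cmp V i j) = edge_cmp W (\<epsilon> i) (\<epsilon> j)"
  using morphism[unfolded chamber_morphism_def, THEN conjunct2, THEN conjunct2] by iprover

lemma image_chambers: "\<phi> ` chambers V = chambers W"
  using covering by (simp add: covering_def surjective_etale_def)

lemma surj: "D \<in> chambers W \<Longrightarrow> \<exists>C\<in>chambers V. \<phi> C = D"
  unfolding image_chambers[symmetric] by blast

lemma star_bij:
  "C \<in> chambers V \<Longrightarrow>
    bij_betw \<epsilon> {i \<in> edges S V. edge_ini V i = C} {i \<in> edges S W. edge_ini W i = \<phi> C}"
  using covering by (simp add: covering_def surjective_etale_def)

lemma edge_lift:
  assumes "C \<in> chambers V" "j \<in> edges S W" "edge_ini W j = \<phi> C"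
  shows "\<exists>i\<in>edges S V. edge_ini V i = C \<and> \<epsilon> i = j"
proof -
  have "j \<in> \<epsilon> ` {i \<in> edges S V. edge_ini V i = C}"
    using star_bij[OF assms(1)] assms(2,3) by (simp add: bij_betw_def)
  then show ?thesis by blast
qed

lemma edge_lift_unique:
  "C \<in> chambers V \<Longrightarrow> i \<in> edges S V \<Longrightarrow> j \<in> edges S V \<Longrightarrow> edge_ini V i = C \<Longrightarrow>
    edge_ini V j = C \<Longrightarrow> \<epsilon> i = \<epsilon> j \<Longrightarrow> i = j"
  by (rule inj_onD[OF bij_betw_imp_inj_on[OF star_bij]]) simp_all

text \<open>Both \<open>j\<close> and the inverse of \<open>i\<close> issue from the terminal
  chamber of \<open>i\<close>, where \<open>\<epsilon>\<close> is injective; hence \<open>j\<close>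
  is inverse to \<open>i\<close> exactly when this holds for the images. One direction serves to
  project the composition move, the other to lift it.\<close>

lemma composable_map_iff:
  assumes "i \<in> edges S V" "j \<in> edges S V" "edge_ter V i = edge_ini V j"
  shows "composable S W (\<epsilon> i) (\<epsilon> j) \<longleftrightarrow> composable S V i j"
proof -
  have "\<epsilon> j = \<epsilon> (edge_inv V i) \<longleftrightarrow> j = edge_inv V i"
    using edge_lift_unique[OF V.edge_ter_chamber[OF assms(1)] assms(2) V.edge_inv(1)[OF assms(1)]]
      assms(3) V.edge_inv(2)[OF assms(1)] by metis
  then show ?thesis
    using assms by (simp add: composable_def edges_map)
qed

lemma gal_ter_map:
  "consecutive S V C a \<Longrightarrow> gal_ter W (\<phi> C, map \<epsilon> a) = \<phi> (gal_ter V (C, a))"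
  by (induction a arbitrary: C) (auto simp: edges_map)

lemma consecutive_map: "consecutive S V C a \<Longrightarrow> consecutive S W (\<phi> C) (map \<epsilon> a)"
  by (induction a arbitrary: C) (auto simp: edges_map)

lemma gallery_map: "gallery S V \<beta> \<Longrightarrow> gallery S W (p \<beta>)"
  by (cases \<beta>) (simp add: gallery_map_def chambers_map consecutive_map)

lemma consecutive_type_map: "consecutive S V C a \<Longrightarrow> map fst (map \<epsilon> a) = map fst a"
  by (induction a arbitrary: C) (auto simp: edges_map)

lemma gal_type_map: "gallery S V \<beta> \<Longrightarrow> gal_type (p \<beta>) = gal_type \<beta>"
  unfolding gallery_map_def gal_type_def gallery_def snd_conv by (blast dest: consecutive_type_map)

section \<open>Unique lifting of galleries\<close>

lemma consecutive_lift:
  "C \<in> chambers V \<Longrightarrow> consecutive S W (\<phi> C) x \<Longrightarrow> \<exists>a. consecutive S V C a \<and> map \<epsilon> a = x"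
proof (induction x arbitrary: C)
  case (Cons j x)
  then obtain i where i: "i \<in> edges S V" "edge_ini V i = C" "\<epsilon> i = j" using edge_lift[of C j] by auto
  \<comment> \<open>The rest of the gallery is lifted from the terminal chamber of the lifted first
    edge, which lies over the terminal chamber of \<open>j\<close>.\<close>
  then obtain a where "consecutive S V (edge_ter V i) a" "map \<epsilon> a = x"
    using Cons.IH[of "edge_ter V i"] Cons.prems V.edge_ter_chamber edges_map(4)[of i] by auto
  then show ?case using i by (intro exI[of _ "i # a"]) simp
qed simp

lemma consecutive_lift_unique:
  "C \<in> chambers V \<Longrightarrow> consecutive S V C a \<Longrightarrow> consecutive S V C b \<Longrightarrow> map \<epsilon> a = map \<epsilon> b \<Longrightarrow> a = b"
proof (induction a arbitrary: C b)
  case (Cons i a)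
  then obtain j b' where b: "b = j # b'" by (cases b) auto
  then have "i = j" using Cons.prems edge_lift_unique[of C i j] by auto
  then show ?case using Cons.IH[of "edge_ter V i" b'] Cons.prems b V.edge_ter_chamber by auto
qed simp

lemma gallery_lift:
  assumes "C \<in> chambers V" "gallery S W \<gamma>" "fst \<gamma> = \<phi> C"
  obtains \<beta> where "gallery S V \<beta>" "fst \<beta> = C" "p \<beta> = \<gamma>"
proof -
  obtain a where "consecutive S V C a" "map \<epsilon> a = snd \<gamma>"
    using consecutive_lift[of C "snd \<gamma>"] assms by (auto simp: gallery_def)
  then show thesis using assms that[of "(C, a)"] by (cases \<gamma>) (auto simp: gallery_map_def)
qed

section \<open>Projecting and lifting homotopies\<close>

text \<open>The conclusion is a homotopy and not a single move because a Weyl morphism sends a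
  defining suite merely to a suite, whose deletion may take several moves.\<close>

lemma elem_homotopy_map:
  assumes "elem_homotopy S M V \<beta> \<gamma>"
  shows "homotopic S M W (p \<beta>) (p \<gamma>)"
  using assms
proof (cases rule: elem_homotopy.cases)
  case (delete_inverse C a i b)
  have "gallery S W (p \<beta>)" using delete_inverse gallery_map by blast
  then show ?thesis
    using delete_inverse edges_map(5)[of i] W.elem_homotopy_homotopic
      elem_homotopy.delete_inverse[of S W "\<phi> C" "map \<epsilon> a" "\<epsilon> i" "map \<epsilon> b" M]
    by (simp add: gallery_map_def)
next
  case (compose C a i j b)
  have "gallery S W (p \<beta>)" using compose gallery_map by blast
  moreover have "composable S W (\<epsilon> i) (\<epsilon> j)"
    using composable_map_iff[of i j] compose by (auto simp: composable_def)
  ultimately show ?thesis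
    using compose cmp_map[of i j] W.elem_homotopy_homotopic
      elem_homotopy.compose[of S W "\<phi> C" "map \<epsilon> a" "\<epsilon> i" "\<epsilon> j" "map \<epsilon> b" M]
    by (simp add: gallery_map_def)
next
  case (delete_suite C a c b)
  have "gallery S W (p \<beta>)" using delete_suite gallery_map by blast
  moreover have "suite S M W (p (gal_ter V (C, a), c))"
    using covering delete_suite(4) by (auto simp: covering_def weyl_morphism_def)
  then have "suite S M W (gal_ter W (\<phi> C, map \<epsilon> a), map \<epsilon> c)"
    using delete_suite(3) gal_ter_map[of C a] by (simp add: gallery_map_def)
  ultimately show ?thesis
    using delete_suite W.homotopic_delete_suite[of "\<phi> C" "map \<epsilon> a" "map \<epsilon> c" "map \<epsilon> b"]
    by (simp add: gallery_map_def)
qed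

lemma homotopic_map:
  assumes "homotopic S M V \<beta> \<gamma>"
  shows "homotopic S M W (p \<beta>) (p \<gamma>)"
  using assms
proof (induction rule: V.homotopic_induct)
  case refl
  show ?case using assms gallery_map W.homotopic_refl by (simp add: homotopic_def)
next
  case (step \<gamma> \<delta>)
  then show ?case using elem_homotopy_map W.homotopic_sym W.homotopic_trans by blast
qed

text \<open>The move is repeated on the lift \<open>\<beta>\<close>. Equality of the initial
  chambers is a hypothesis because \<open>\<phi>\<close> may identify chambers, and the result is
  only a homotopy because a lifted defining suite is only a suite.\<close>

lemma elem_homotopy_lift:
  assumes h: "elem_homotopy S M W (p \<beta>) (p \<gamma>)"
    and \<beta>: "gallery S V \<beta>" and \<gamma>: "gallery S V \<gamma>" and fst: "fst \<beta> = fst \<gamma>"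
  shows "homotopic S M V \<beta> \<gamma>"
proof -
  obtain C x y where xy: "\<beta> = (C, x)" "\<gamma> = (C, y)" using fst by (cases \<beta>, cases \<gamma>) auto
  have C: "C \<in> chambers V" using \<beta> xy by simp
  \<comment> \<open>A move on the lift of \<open>p \<beta>\<close> over the given one ends at \<open>\<gamma>\<close> by uniqueness of lifts.\<close>
  have lift: "homotopic S M V \<beta> \<gamma>" if "homotopic S M V (C, x) (C, z)" "map \<epsilon> z = map \<epsilon> y" for z
  proof -
    have "z = y"
      using consecutive_lift_unique[of C z y] that \<gamma> xy by (auto simp: homotopic_def)
    then show ?thesis using that xy by simp
  qed
  from h show ?thesis
  proof (cases rule: elem_homotopy.cases)
    case (delete_inverse D a' i' b')
    then have m: "map \<epsilon> x = a' @ [i', edge_inv W i'] @ b'" "map \<epsilon> y = a' @ b'"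
      by (auto simp: xy gallery_map_def)
    from m(1) obtain a i j b where x: "x = a @ [i, j] @ b" "map \<epsilon> a = a'" "\<epsilon> i = i'"
      "\<epsilon> j = edge_inv W i'" "map \<epsilon> b = b'"
      by (auto simp: map_eq_append_conv map_eq_Cons_conv)
    have ij: "i \<in> edges S V" "j \<in> edges S V" "edge_ini V j = edge_ter V i" using \<beta> xy x by auto
    \<comment> \<open>Both edges issue from the terminal chamber of \<open>i\<close> and have the
      same image.\<close>
    have "j = edge_inv V i"
      using edge_lift_unique[of "edge_ter V i" j "edge_inv V i"] ij x edges_map(5)[of i]
        V.edge_inv[of i] V.edge_ter_chamber[of i] by auto
    then have "homotopic S M V (C, x) (C, a @ b)"
      using V.elem_homotopy_homotopic elem_homotopy.delete_inverse[of S V C a i b M] \<beta> xy x by simp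
    then show ?thesis using lift m x by simp
  next
    case (compose D a' i' j' b')
    then have m: "map \<epsilon> x = a' @ [i', j'] @ b'" "map \<epsilon> y = a' @ [edge_cmp W i' j'] @ b'"
      by (auto simp: xy gallery_map_def)
    from m(1) obtain a i j b where x: "x = a @ [i, j] @ b" "map \<epsilon> a = a'" "\<epsilon> i = i'"
      "\<epsilon> j = j'" "map \<epsilon> b = b'"
      by (auto simp: map_eq_append_conv map_eq_Cons_conv)
    have "composable S V i j"
      using composable_map_iff[of i j] \<beta> xy x compose by auto
    then have "homotopic S M V (C, x) (C, a @ [edge_cmp V i j] @ b)" "\<epsilon> (edge_cmp V i j) = edge_cmp W i' j'"
      using V.elem_homotopy_homotopic elem_homotopy.compose[of S V C a i j b M] \<beta> xy x
        cmp_map[of i j] by simp_all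
    then show ?thesis using lift m x by simp
  next
    case (delete_suite D a' c' b')
    then have m: "map \<epsilon> x = a' @ c' @ b'" "map \<epsilon> y = a' @ b'" and D: "D = \<phi> C"
      by (auto simp: xy gallery_map_def)
    from m(1) obtain a c b where x: "x = a @ c @ b" "map \<epsilon> a = a'" "map \<epsilon> c = c'" "map \<epsilon> b = b'"
      by (auto simp: map_eq_append_conv append_eq_map_conv)
    \<comment> \<open>A lift of a cycle might fail to close up; here the covering condition, applied
      to the part \<open>c\<close> over the defining suite, makes it a suite and so closed.\<close>
    have "gallery S V (gal_ter V (C, a), c)" using \<beta> xy x C V.gal_ter_chamber[of C a] by simp
    moreover have "p (gal_ter V (C, a), c) = (gal_ter W (D, a'), c')"
      using gal_ter_map[of C a] \<beta> xy x D by (auto simp: gallery_map_def)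
    ultimately have "suite S M V (gal_ter V (C, a), c)"
      using covering delete_suite(4) by (simp add: covering_def)
    then have "homotopic S M V (C, x) (C, a @ b)"
      using V.homotopic_delete_suite[of C a c b] \<beta> xy x by simp
    then show ?thesis using lift m x by simp
  qed
qed

lemma homotopic_lift:
  assumes "homotopic S M W (p \<beta>) (p \<gamma>)" "gallery S V \<beta>" "gallery S V \<gamma>" "fst \<beta> = fst \<gamma>"
  shows "homotopic S M V \<beta> \<gamma>"
proof -
  \<comment> \<open>The claim is strengthened to every lift, from the initial chamber of
    \<open>\<beta>\<close>, of the gallery reached so far. The base case is uniqueness of
    lifts.\<close>
  have "\<forall>\<gamma>'. gallery S V \<gamma>' \<longrightarrow> fst \<gamma>' = fst \<beta> \<longrightarrow> p \<gamma>' = p \<gamma> \<longrightarrow> homotopic S M V \<beta> \<gamma>'"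
    using assms(1)
  proof (induction rule: W.homotopic_induct)
    case refl
    have "\<beta> = \<gamma>'" if "gallery S V \<gamma>'" "fst \<gamma>' = fst \<beta>" "p \<gamma>' = p \<beta>" for \<gamma>'
      using consecutive_lift_unique[of "fst \<beta>" "snd \<beta>" "snd \<gamma>'"] assms(2) that
      by (auto simp: gallery_def gallery_map_def prod_eq_iff)
    then show ?case using V.homotopic_refl[OF assms(2)] by metis
  next
    case (step \<delta> \<eta>)
    show ?case
    proof (intro allI impI)
      fix \<gamma>' assume g: "gallery S V \<gamma>'" "fst \<gamma>' = fst \<beta>" "p \<gamma>' = \<eta>"
      have "gallery S W \<delta>" "fst \<delta> = \<phi> (fst \<beta>)"
        using step.hyps(1) W.homotopic_invariants[OF step.hyps(1)]
        by (auto simp: homotopic_def gallery_map_def)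
      moreover have "fst \<beta> \<in> chambers V" using assms(2) by (simp add: gallery_def)
      \<comment> \<open>The intermediate gallery exists only in \<open>W\<close>; its lift from the
        initial chamber of \<open>\<beta>\<close> gives the move two lifted ends.\<close>
      ultimately obtain \<delta>' where d: "gallery S V \<delta>'" "fst \<delta>' = fst \<beta>" "p \<delta>' = \<delta>"
        using gallery_lift by metis
      have "homotopic S M V \<delta>' \<gamma>'"
        using step.hyps(2) elem_homotopy_lift[of \<delta>' \<gamma>'] elem_homotopy_lift[of \<gamma>' \<delta>']
          V.homotopic_sym g d by metis
      then show "homotopic S M V \<beta> \<gamma>'" using step.IH d V.homotopic_trans by blast
    qed
  qed
  then show ?thesis using assms by metis
qed

lemma gallery_lift_ex:
  assumes "gallery S W \<gamma>"
  obtains \<beta> where "gallery S V \<beta>" "p \<beta> = \<gamma>"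
proof -
  obtain C where C: "C \<in> chambers V" "\<phi> C = fst \<gamma>" using surj[of "fst \<gamma>"] assms by (auto simp: gallery_def)
  then show thesis using gallery_lift[OF C(1) assms] that by metis
qed

text \<open>Serves when the second gallery is given only in \<open>W\<close>: homotopic galleries
  share their initial chamber, so it can be lifted from that of \<open>\<beta>\<close>.\<close>

lemma homotopic_lift_right:
  assumes "homotopic S M W (p \<beta>) \<gamma>" "gallery S V \<beta>"
  obtains \<gamma>' where "homotopic S M V \<beta> \<gamma>'" "p \<gamma>' = \<gamma>"
proof -
  have "fst \<beta> \<in> chambers V" "gallery S W \<gamma>" "fst \<gamma> = \<phi> (fst \<beta>)"
    using assms W.homotopic_invariants[OF assms(1)]
    by (auto simp: homotopic_def gallery_def gallery_map_def)
  then obtain \<gamma>' where "gallery S V \<gamma>'" "fst \<gamma>' = fst \<beta>" "p \<gamma>' = \<gamma>" by (rule gallery_lift)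
  then show thesis using that homotopic_lift assms by metis
qed

section \<open>Transfer of the Weyl graph conditions\<close>

lemma issuing_edge_iff:
  assumes "C \<in> chambers V"
  shows "(\<exists>i\<in>edges S W. fst i = s \<and> edge_ini W i = \<phi> C) \<longleftrightarrow>
    (\<exists>i\<in>edges S V. fst i = s \<and> edge_ini V i = C)"
  using edge_lift[OF assms] edges_map by metis

lemma trivial_panel_map_iff:
  "s \<in> S \<Longrightarrow> C \<in> chambers V \<Longrightarrow>
    trivial_groupoid (component (panel_groupoid W s) (\<phi> C)) \<longleftrightarrow>
    trivial_groupoid (component (panel_groupoid V s) C)"
  using issuing_edge_iff chambers_map by (simp add: V.trivial_panel_iff W.trivial_panel_iff)

lemma max_geodesic_map:
  "gallery S V \<beta> \<Longrightarrow> max_geodesic S M W s t (p \<beta>) \<longleftrightarrow> max_geodesic S M V s t \<beta>"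
  by (simp add: max_geodesic_def gallery_map gal_type_map)

lemma geodesic_map: "gallery S V \<beta> \<Longrightarrow> geodesic S M W (p \<beta>) \<longleftrightarrow> geodesic S M V \<beta>"
  by (simp add: geodesic_def gallery_map gal_type_map)

lemma gal_length_map: "gallery S V \<beta> \<Longrightarrow> gal_length S M (p \<beta>) = gal_length S M \<beta>"
  by (simp add: gal_length_def gal_type_map)

lemma pw0_iff:
  "(\<forall>s\<in>S. \<forall>C\<in>chambers V. \<not> trivial_groupoid (component (panel_groupoid V s) C)) \<longleftrightarrow>
   (\<forall>s\<in>S. \<forall>D\<in>chambers W. \<not> trivial_groupoid (component (panel_groupoid W s) D))"
proof -
  \<comment> \<open>Surjectivity on chambers lets PW0 for \<open>W\<close> be tested at the images
    of the chambers of \<open>V\<close> alone.\<close>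
  have "(\<forall>D\<in>chambers W. P D) \<longleftrightarrow> (\<forall>C\<in>chambers V. P (\<phi> C))" for P
    using surj chambers_map by blast
  then show ?thesis using trivial_panel_map_iff by simp
qed

text \<open>Downwards, the given geodesic is lifted and the homotopy found in \<open>V\<close> is
  projected; upwards, the geodesic is projected and the one found in \<open>W\<close> is lifted
  together with the homotopy. Types are unchanged throughout.\<close>

lemma pw1_iff:
  "(\<forall>\<beta>. max_geodesic S M V s t \<beta> \<longrightarrow> (\<exists>\<gamma>. max_geodesic S M V t s \<gamma> \<and> homotopic S M V \<beta> \<gamma>)) \<longleftrightarrow>
   (\<forall>\<beta>. max_geodesic S M W s t \<beta> \<longrightarrow> (\<exists>\<gamma>. max_geodesic S M W t s \<gamma> \<and> homotopic S M W \<beta> \<gamma>))"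
  (is "?V \<longleftrightarrow> ?W")
proof
  assume V: ?V
  show ?W
  proof (intro allI impI)
    fix \<beta> assume b: "max_geodesic S M W s t \<beta>"
    then obtain \<beta>' where b': "gallery S V \<beta>'" "p \<beta>' = \<beta>"
      by (auto simp: max_geodesic_def elim: gallery_lift_ex)
    then obtain \<gamma>' where "max_geodesic S M V t s \<gamma>'" "homotopic S M V \<beta>' \<gamma>'"
      using V b max_geodesic_map by blast
    then show "\<exists>\<gamma>. max_geodesic S M W t s \<gamma> \<and> homotopic S M W \<beta> \<gamma>"
      using b' homotopic_map max_geodesic_map by (metis homotopic_def)
  qed
next
  assume W: ?W
  show ?V
  proof (intro allI impI)
    fix \<beta> assume b: "max_geodesic S M V s t \<beta>"
    then have g: "gallery S V \<beta>" by (simp add: max_geodesic_def)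
    then obtain \<gamma> where c: "max_geodesic S M W t s \<gamma>" "homotopic S M W (p \<beta>) \<gamma>"
      using W b max_geodesic_map by blast
    then obtain \<gamma>' where "homotopic S M V \<beta> \<gamma>'" "p \<gamma>' = \<gamma>" using homotopic_lift_right g by metis
    then show "\<exists>\<gamma>. max_geodesic S M V t s \<gamma> \<and> homotopic S M V \<beta> \<gamma>"
      using c max_geodesic_map by (metis homotopic_def)
  qed
qed

lemma pre_weyl_graph_iff: "pre_weyl_graph S M V \<longleftrightarrow> pre_weyl_graph S M W"
  using V.weyl_data W.weyl_data by (simp only: V.pre_weyl_graph_alt W.pre_weyl_graph_alt pw0_iff pw1_iff)

lemma homotopic_geodesics_length_iff:
  "(\<forall>\<beta> \<gamma>. geodesic S M V \<beta> \<and> geodesic S M V \<gamma> \<and> homotopic S M V \<beta> \<gamma> \<longrightarrow>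
      gal_length S M \<beta> = gal_length S M \<gamma>) \<longleftrightarrow>
   (\<forall>\<beta> \<gamma>. geodesic S M W \<beta> \<and> geodesic S M W \<gamma> \<and> homotopic S M W \<beta> \<gamma> \<longrightarrow>
      gal_length S M \<beta> = gal_length S M \<gamma>)"
  (is "?V \<longleftrightarrow> ?W")
proof
  assume V: ?V
  show ?W
  proof (intro allI impI, elim conjE)
    fix \<beta> \<gamma> assume h: "geodesic S M W \<beta>" "geodesic S M W \<gamma>" "homotopic S M W \<beta> \<gamma>"
    then obtain \<beta>' where b: "gallery S V \<beta>'" "p \<beta>' = \<beta>"
      by (auto simp: geodesic_def elim: gallery_lift_ex)
    \<comment> \<open>Lifting \<open>\<gamma>\<close> along the homotopy makes it start where
      \<open>\<beta>'\<close> does; an arbitrary lift need not be homotopic to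
      \<open>\<beta>'\<close>.\<close>
    then obtain \<gamma>' where c: "homotopic S M V \<beta>' \<gamma>'" "p \<gamma>' = \<gamma>"
      using homotopic_lift_right h(3) by metis
    then have "gallery S V \<gamma>'" by (simp add: homotopic_def)
    then show "gal_length S M \<beta> = gal_length S M \<gamma>"
      using V b c h geodesic_map gal_length_map by metis
  qed
next
  assume W: ?W
  show ?V
  proof (intro allI impI, elim conjE)
    fix \<beta> \<gamma> assume h: "geodesic S M V \<beta>" "geodesic S M V \<gamma>" "homotopic S M V \<beta> \<gamma>"
    then have "gallery S V \<beta>" "gallery S V \<gamma>" by (simp_all add: geodesic_def)
    then show "gal_length S M \<beta> = gal_length S M \<gamma>"
      using W h homotopic_map geodesic_map gal_length_map by metis
  qed
qed

lemma weyl_graph_iff: "weyl_graph S M V \<longleftrightarrow> weyl_graph S M W"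
  by (simp only: weyl_graph_def pre_weyl_graph_iff homotopic_geodesics_length_iff)

end

theorem theorem5p9:
  fixes S :: "'s set" and M :: "'s \<Rightarrow> 's \<Rightarrow> enat"
    and Wt :: "('s, 'c, 'e) weyl_data" and W :: "('s, 'd, 'f) weyl_data"
    and \<phi> :: "'c \<Rightarrow> 'd" and \<epsilon> :: "('s, 'e) edge \<Rightarrow> ('s, 'f) edge"
  assumes "coxeter_matrix S M"
    and "weyl_data S M Wt" and "weyl_data S M W"
    and "covering S M Wt W \<phi> \<epsilon>"
  shows "weyl_graph S M Wt \<longleftrightarrow> weyl_graph S M W"
  using weyl_covering.weyl_graph_iff[OF weyl_covering.intro] assms(4) .

end
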